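(* Let $S\subseteq\mathbb{R}$ be a fixed measurable state space with Borel sigma-algebra $\mathcal{B}(S)$, let $(B_n)_{n\ge0}$ be the time-homogeneous Markov chain $B_{n+1}=\Phi(B_n,Y_{n+1})$ on $S$ with transition kernel $\kappa(s,A)=\mathbb{P}\{\Phi(s,Y)\in A\}$, $s\in S$, $A\in\mathcal{B}(S)$, and let $\Pi_n(A)=\mathbb{P}(B_n\in A)$ be the law of $B_n$. Let $C\subset S$ be a fixed countable set (not depending on $n$), and assume that none of the measures $\Pi_n$ ($n\ge0$) and $\kappa(s,\cdot)$ ($s\in S$) has a singular continuous part and that all their atoms lie in $C$, so that for all $A\in\mathcal{B}(S)$ $$\Pi_n(A)=\sum_{c\in C}p_{c,n}\,\delta_c(A)+\int_{A\cap(S\setminus C)}g_n(s)\,\mathrm{d}s,\qquad \kappa(s,A)=\sum_{c\in C}a(c|s)\,\delta_c(A)+\int_{A\cap(S\setminus C)}k(b|s)\,\mathrm{d}b,$$ where $p_{c,n}=\Pi_n(\{c\})$, $a(c|s)=\kappa(s,\{c\})$, and $g_n=\frac{\mathrm{d}(\Pi_n|_{S\setminus C})}{\mathrm{d}\lambda}$ and $k(\cdot|s)=\frac{\mathrm{d}\kappa(s,\cdot)}{\mathrm{d}\lambda}$ on $S\setminus C$ are Radon–Nikodym derivatives with respect to Lebesgue measure $\lambda$ on $S\setminus C$. Then the atomic and absolutely continuous parts evolve according to $$p_{c,n+1}=\sum_{c'\in C}p_{c',n}\,a(c|c')+\int_{S\setminus C}a(c|s)\,g_n(s)\,\mathrm{d}s,\qquad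 c\in C,$$ $$g_{n+1}(b)=\sum_{c'\in C}p_{c',n}\,k(b|c')+\int_{S\setminus C}k(b|s)\,g_n(s)\,\mathrm{d}s,\qquad b\in S\setminus C.$$
   Context: $(Y_n)_{n\ge1}$ is a sequence of independent identically distributed real random variables on a probability space $(\Omega,\mathcal{F},\mathbb{P})$, and $Y$ is a generic random variable with their common law. $\Phi:S\times\mathbb{R}\to S$ is a deterministic update map, and $B_0=b_0\in S$ is given; each $B_n$ is a random variable measurable with respect to $\sigma(Y_1,\dots,Y_n)$. $\kappa$ is a Markov transition kernel: $s\mapsto\kappa(s,A)$ is Borel measurable for each fixed $A\in\mathcal{B}(S)$, and $A\mapsto\kappa(s,A)$ is a probability measure for each fixed $s\in S$. $\delta_c$ is the Dirac measure at $c$.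
   Formalization: The update map Φ is taken jointly measurable, the densities k(b|s) are taken jointly measurable in (b,s), and the recursion for g_{n+1}(b) is asserted for Lebesgue-almost every b in S∖C, since Radon–Nikodym derivatives are determined only almost everywhere. *)

theory Defs
  imports "HOL-Probability.Probability"
begin

abbreviation borel_on :: "real set \<Rightarrow> real measure" where
  "borel_on S \<equiv> restrict_space borel S"

abbreviation leb_on :: "real set \<Rightarrow> real measure" where
  "leb_on S \<equiv> restrict_space lborel S"

text \<open>For a Borel measure on a subset of the line the atoms may be identified with points.\<close>

definition atoms :: "real measure \<Rightarrow> real set" where
  "atoms \<mu> = {x \<in> space \<mu>. emeasure \<mu> {x} > 0}"

text \<open>In the Lebesgue decomposition of \<open>\<mu>\<close> into an atomic, an absolutely continuous and a
  singular continuous measure the last one vanishes, so \<open>\<mu>\<close> is the sum of the first two.\<close>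

definition no_singular_continuous_part :: "real set \<Rightarrow> real measure \<Rightarrow> bool" where
  "no_singular_continuous_part S \<mu> \<longleftrightarrow>
     (\<exists>\<mu>d \<mu>ac. sets \<mu>d = sets (borel_on S) \<and> sets \<mu>ac = sets (borel_on S) \<and>
        (\<exists>D. countable D \<and> D \<subseteq> S \<and> emeasure \<mu>d (S - D) = 0) \<and>
        absolutely_continuous (leb_on S) \<mu>ac \<and>
        (\<forall>A\<in>sets (borel_on S). emeasure \<mu> A = emeasure \<mu>d A + emeasure \<mu>ac A))"

text \<open>The library's \<open>RN_deriv\<close> selects one version of the derivative; here \<open>f\<close> may be any
  version.\<close>

definition is_RN_deriv :: "'a measure \<Rightarrow> 'a measure \<Rightarrow> ('a \<Rightarrow> ennreal) \<Rightarrow> bool" where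
  "is_RN_deriv M N f \<longleftrightarrow> f \<in> borel_measurable M \<and> density M f = N"

text \<open>A family of derivatives on \<open>S - C\<close> of the measures \<open>\<kappa> s\<close>, \<open>s \<in> S\<close>. Each is determined only
  up to a null set depending on \<open>s\<close>. As usual for densities of kernels, the versions
  are taken jointly measurable, without which integrals of \<open>k b s\<close> over \<open>s\<close> need not make sense
  or be independent of the versions.\<close>

definition is_kernel_density ::
    "real set \<Rightarrow> real set \<Rightarrow> (real \<Rightarrow> real measure) \<Rightarrow> (real \<Rightarrow> real \<Rightarrow> ennreal) \<Rightarrow> bool" where
  "is_kernel_density S C \<kappa> k \<longleftrightarrow>
     (\<lambda>(b, s). k b s) \<in> borel_measurable (borel_on (S - C) \<Otimes>\<^sub>M borel_on S) \<and>
     (\<forall>s\<in>S. is_RN_deriv (leb_on (S - C)) (restrict_space (\<kappa> s) (S - C)) (\<lambda>b. k b s))"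

end

(* As B n is a function of Y 1, ..., Y n, it is independent of Y (n + 1), which gives the
   Chapman-Kolmogorov equation law (n + 1) A = \<integral> \<kappa> s A d(law n)(s). Splitting the integral against
   law n into its atoms and its density, the case A = {c} is the evolution of the atoms. For
   A \<subseteq> S - C, Tonelli turns the right-hand side into the integral over A of the claimed density,
   and densities with respect to a sigma-finite measure are almost everywhere unique. *)

theory Submission
  imports Defs
begin

section \<open>Countable sums in \<open>ennreal\<close> as integrals against counting
  measure\<close>

text \<open>Every family in \<open>ennreal\<close> is summable, so along an enumeration of an
  infinite \<open>C\<close> the unordered sum is the sum of a series, and so is the integral. This
  bridge lets Tonelli and measurability results for integrals and series act on
  \<open>infsum\<close>.\<close>

lemma nn_integral_count_space_eq_infsum:
  fixes f :: "'a \<Rightarrow> ennreal"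
  assumes "countable C"
  shows "(\<integral>\<^sup>+c. f c \<partial>count_space C) = (\<Sum>\<^sub>\<infinity>c\<in>C. f c)"
proof (cases "finite C")
  case True
  then show ?thesis
    by (simp add: nn_integral_count_space_finite)
next
  case False
  note bij = bij_betw_from_nat_into[OF assms False]
  have "(\<lambda>i. f (from_nat_into C i)) summable_on UNIV"
    by (rule nonneg_summable_on_complete) simp
  then have "(\<lambda>i. f (from_nat_into C i)) sums (\<Sum>\<^sub>\<infinity>i. f (from_nat_into C i))"
    by (intro has_sum_imp_sums has_sum_infsum)
  then have "(\<Sum>i. f (from_nat_into C i)) = (\<Sum>\<^sub>\<infinity>i. f (from_nat_into C i))"
    by (rule sums_unique[symmetric])
  also have "\<dots> = (\<Sum>\<^sub>\<infinity>c\<in>C. f c)"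
    by (rule infsum_reindex_bij_betw[OF bij])
  finally show ?thesis
    by (simp add: nn_integral_bij_count_space[symmetric, OF bij] nn_integral_count_space_nat)
qed

lemma nn_integral_infsum:
  fixes f :: "'i \<Rightarrow> 'a \<Rightarrow> ennreal"
  assumes C: "countable C" and f: "\<And>c. c \<in> C \<Longrightarrow> f c \<in> borel_measurable M"
  shows "(\<integral>\<^sup>+x. (\<Sum>\<^sub>\<infinity>c\<in>C. f c x) \<partial>M) = (\<Sum>\<^sub>\<infinity>c\<in>C. \<integral>\<^sup>+x. f c x \<partial>M)"
  using nn_integral_count_space_nn_integral[OF C f]
  by (simp add: nn_integral_count_space_eq_infsum[OF C])

lemma borel_measurable_infsum:
  fixes f :: "'i \<Rightarrow> 'a \<Rightarrow> ennreal"
  assumes C: "countable C" and f: "\<And>c. c \<in> C \<Longrightarrow> f c \<in> borel_measurable M"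
  shows "(\<lambda>x. \<Sum>\<^sub>\<infinity>c\<in>C. f c x) \<in> borel_measurable M"
proof (cases "finite C")
  case True
  with f show ?thesis by simp
next
  case False
  note bij = bij_betw_from_nat_into[OF C False]
  have "(\<Sum>\<^sub>\<infinity>c\<in>C. f c x) = (\<Sum>i. f (from_nat_into C i) x)" for x
    by (simp add: nn_integral_count_space_eq_infsum[OF C, symmetric]
        nn_integral_bij_count_space[symmetric, OF bij] nn_integral_count_space_nat)
  moreover have "from_nat_into C i \<in> C" for i
    using False by (intro from_nat_into) auto
  ultimately show ?thesis
    using f by simp
qed

text \<open>Going through the counting measure also covers \<open>x = \<infinity>\<close>, where
  multiplication by \<open>x\<close> is not continuous at 0.\<close>

lemma infsum_mult_right_ennreal:
  fixes f :: "'a \<Rightarrow> ennreal"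
  assumes C: "countable C"
  shows "(\<Sum>\<^sub>\<infinity>c\<in>C. f c * x) = (\<Sum>\<^sub>\<infinity>c\<in>C. f c) * x"
  by (simp add: nn_integral_count_space_eq_infsum[OF C, symmetric] nn_integral_multc)

section \<open>Integration against a measure with point masses on \<open>C\<close> and a density off
  \<open>C\<close>\<close>

text \<open>Cut \<open>h\<close> into its values at the points of \<open>C\<close> and its
  restriction to \<open>S - C\<close>. Each point contributes its mass times the value of
  \<open>h\<close> there, and on \<open>S - C\<close> the measure is
  \<open>density (leb_on (S - C)) f\<close>.\<close>

lemma nn_integral_atoms_density:
  assumes sets: "sets \<mu> = sets (borel_on S)"
    and S: "S \<in> sets borel" and C: "countable C" "C \<subseteq> S"
    and f: "is_RN_deriv (leb_on (S - C)) (restrict_space \<mu> (S - C)) f"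
    and h: "h \<in> borel_measurable \<mu>"
  shows "(\<integral>\<^sup>+s. h s \<partial>\<mu>) =
    (\<Sum>\<^sub>\<infinity>c\<in>C. emeasure \<mu> {c} * h c) + (\<integral>\<^sup>+s. h s * f s \<partial>leb_on (S - C))"
proof -
  have space: "space \<mu> = S"
    using sets_eq_imp_space_eq[OF sets] by (simp add: space_restrict_space)
  have single: "{c} \<in> sets \<mu>" if "c \<in> C" for c
    using that C S by (auto simp: sets sets_restrict_space_iff)
  have "C \<in> sets borel"
    using C(1) by (rule sets.countable[rotated]) simp
  then have SC: "S - C \<in> sets borel" "S - C \<in> sets \<mu>"
    using S by (auto simp: sets sets_restrict_space_iff)
  \<comment> \<open>At most one singleton contains \<open>s\<close>, so the sum over
    \<open>C\<close> has at most one nonzero term. It is written as an integral over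
    \<open>count_space C\<close> so that exchanging it with the integral against
    \<open>\<mu>\<close> is Tonelli.\<close>
  have split: "h s = (\<integral>\<^sup>+c. h c * indicator {c} s \<partial>count_space C) + h s * indicator (S - C) s"
    if "s \<in> S" for s
  proof (cases "s \<in> C")
    case True
    have "(\<integral>\<^sup>+c. h c * indicator {c} s \<partial>count_space C) = (\<Sum>c\<in>{s}. h c * indicator {c} s)"
      using True by (intro nn_integral_count_space') (auto split: split_indicator)
    with True show ?thesis by simp
  next
    case False
    then have "(\<integral>\<^sup>+c. h c * indicator {c} s \<partial>count_space C) = (\<integral>\<^sup>+c. 0 \<partial>count_space C)"
      by (intro nn_integral_cong) (auto split: split_indicator)
    with False that show ?thesis by simp
  qed
  have meas: "(\<lambda>s. \<integral>\<^sup>+c. h c * indicator {c} s \<partial>count_space C) \<in> borel_measurable \<mu>"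
    unfolding nn_integral_count_space_eq_infsum[OF C(1)]
    using single C(1) by (intro borel_measurable_infsum) auto
  have "(\<integral>\<^sup>+s. h s \<partial>\<mu>) =
      (\<integral>\<^sup>+s. (\<integral>\<^sup>+c. h c * indicator {c} s \<partial>count_space C) + h s * indicator (S - C) s \<partial>\<mu>)"
    by (intro nn_integral_cong split) (simp add: space)
  also have "\<dots> = (\<integral>\<^sup>+s. \<integral>\<^sup>+c. h c * indicator {c} s \<partial>count_space C \<partial>\<mu>) + (\<integral>\<^sup>+s\<in>S - C. h s \<partial>\<mu>)"
    using meas h SC(2) by (intro nn_integral_add) auto
  also have "(\<integral>\<^sup>+s. \<integral>\<^sup>+c. h c * indicator {c} s \<partial>count_space C \<partial>\<mu>) =
      (\<integral>\<^sup>+c. \<integral>\<^sup>+s. h c * indicator {c} s \<partial>\<mu> \<partial>count_space C)"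
    using C(1) single by (intro nn_integral_count_space_nn_integral) auto
  also have "\<dots> = (\<integral>\<^sup>+c. emeasure \<mu> {c} * h c \<partial>count_space C)"
    using single by (intro nn_integral_cong) (simp add: nn_integral_cmult mult.commute)
  also have "\<dots> = (\<Sum>\<^sub>\<infinity>c\<in>C. emeasure \<mu> {c} * h c)"
    by (rule nn_integral_count_space_eq_infsum[OF C(1)])
  also have "(\<integral>\<^sup>+s\<in>S - C. h s \<partial>\<mu>) = (\<integral>\<^sup>+s. h s \<partial>restrict_space \<mu> (S - C))"
    using SC(2) space by (subst nn_integral_restrict_space) (auto simp: Int_absorb2)
  also have "restrict_space \<mu> (S - C) = density (leb_on (S - C)) f"
    using f by (simp add: is_RN_deriv_def)
  also have "integral\<^sup>N \<dots> h = (\<integral>\<^sup>+s. h s * f s \<partial>leb_on (S - C))"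
  \<comment> \<open>\<open>h\<close> is measurable for \<open>\<mu>\<close>, but
    \<open>nn_integral_density\<close> wants it measurable for \<open>leb_on (S - C)\<close>. The
    density equation in \<open>f\<close> itself shows that the two sigma-algebras on
    \<open>S - C\<close> coincide.\<close>
  proof -
    have "h \<in> borel_measurable (restrict_space \<mu> (S - C))"
      using h by (rule measurable_restrict_space1)
    moreover have "sets (restrict_space \<mu> (S - C)) = sets (leb_on (S - C))"
      using f by (metis is_RN_deriv_def sets_density)
    ultimately have "h \<in> borel_measurable (leb_on (S - C))"
      by (simp cong: measurable_cong_sets)
    moreover have "f \<in> borel_measurable (leb_on (S - C))"
      using f by (simp add: is_RN_deriv_def)
    ultimately show ?thesis
      by (simp add: nn_integral_density mult.commute)
  qed
  finally show ?thesis .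
qed

text \<open>The case \<open>h = indicator A\<close>: the value \<open>h c\<close> is the mass that
  the Dirac measure \<open>return (borel_on S) c\<close> gives to \<open>A\<close>.\<close>

corollary emeasure_atoms_density:
  assumes sets: "sets \<mu> = sets (borel_on S)"
    and S: "S \<in> sets borel" and C: "countable C" "C \<subseteq> S"
    and f: "is_RN_deriv (leb_on (S - C)) (restrict_space \<mu> (S - C)) f"
    and A: "A \<in> sets (borel_on S)"
  shows "emeasure \<mu> A =
    (\<Sum>\<^sub>\<infinity>c\<in>C. emeasure \<mu> {c} * emeasure (return (borel_on S) c) A) + (\<integral>\<^sup>+s\<in>A. f s \<partial>leb_on (S - C))"
proof -
  have "indicator A \<in> borel_measurable \<mu>"
    using A by (simp add: sets borel_measurable_indicator)
  from nn_integral_atoms_density[OF sets S C f this] A show ?thesis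
    by (simp add: sets mult.commute[of "indicator A _"])
qed

section \<open>The recursion and its one-step transition of laws\<close>

text \<open>Unrolling the recursion exhibits \<open>B n\<close> as a measurable function of the
  first \<open>n\<close> innovations, the form in which independence from \<open>Y (Suc n)\<close>
  can be used. For \<open>n = 0\<close> the index set is empty and \<open>F\<close> is the constant
  \<open>b0\<close>.\<close>

lemma random_recursion_adapted:
  fixes Y :: "nat \<Rightarrow> 'w \<Rightarrow> 'b" and B :: "nat \<Rightarrow> 'w \<Rightarrow> 'a"
  assumes \<Phi>: "(\<lambda>(s, y). \<Phi> s y) \<in> T \<Otimes>\<^sub>M N \<rightarrow>\<^sub>M T" and b0: "b0 \<in> space T"
    and B_0: "\<And>\<omega>. \<omega> \<in> \<Omega> \<Longrightarrow> B 0 \<omega> = b0"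
    and B_Suc: "\<And>n \<omega>. \<omega> \<in> \<Omega> \<Longrightarrow> B (Suc n) \<omega> = \<Phi> (B n \<omega>) (Y (Suc n) \<omega>)"
  shows "\<exists>F. F \<in> PiM {1..n} (\<lambda>_. N) \<rightarrow>\<^sub>M T \<and> (\<forall>\<omega>\<in>\<Omega>. B n \<omega> = F (\<lambda>i\<in>{1..n}. Y i \<omega>))"
proof (induction n)
  case 0
  show ?case
    using b0 by (intro exI[of _ "\<lambda>_. b0"]) (simp add: B_0)
next
  case (Suc n)
  then obtain F where F: "F \<in> PiM {1..n} (\<lambda>_. N) \<rightarrow>\<^sub>M T"
    and BF: "\<And>\<omega>. \<omega> \<in> \<Omega> \<Longrightarrow> B n \<omega> = F (\<lambda>i\<in>{1..n}. Y i \<omega>)"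
    by blast
  \<comment> \<open>Feed the first \<open>n\<close> coordinates to \<open>F\<close>, then apply one
    update with coordinate \<open>Suc n\<close>.\<close>
  define G where "G = (\<lambda>y. (\<lambda>(s, y). \<Phi> s y) (F (restrict y {1..n}), y (Suc n)))"
  have "(\<lambda>y. F (restrict y {1..n})) \<in> PiM {1..Suc n} (\<lambda>_. N) \<rightarrow>\<^sub>M T"
    by (rule measurable_compose[OF measurable_restrict_subset F]) auto
  moreover have "(\<lambda>y. y (Suc n)) \<in> PiM {1..Suc n} (\<lambda>_. N) \<rightarrow>\<^sub>M N"
    by (rule measurable_component_singleton) simp
  ultimately have "G \<in> PiM {1..Suc n} (\<lambda>_. N) \<rightarrow>\<^sub>M T"
    unfolding G_def by (intro measurable_compose[OF measurable_Pair \<Phi>])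
  moreover have "B (Suc n) \<omega> = G (\<lambda>i\<in>{1..Suc n}. Y i \<omega>)" if "\<omega> \<in> \<Omega>" for \<omega>
    using that by (simp add: G_def B_Suc BF restrict_restrict Int_absorb1 atLeastatMost_subset_iff)
  ultimately show ?case by blast
qed

text \<open>\<open>B n\<close> depends only on the indices \<open>{1..n}\<close>, which miss
  \<open>Suc n\<close>. Hence \<open>B n\<close> and \<open>Y (Suc n)\<close> are independent, their
  joint law is the product of their laws, and \<open>\<Phi>\<close> pushes it forward to the next
  law.\<close>

lemma (in prob_space) distr_random_recursion_Suc:
  fixes Y B :: "nat \<Rightarrow> 'a \<Rightarrow> 'b"
  assumes indep: "indep_vars (\<lambda>_. N) Y {1..}"
    and \<Phi>: "(\<lambda>(s, y). \<Phi> s y) \<in> T \<Otimes>\<^sub>M N \<rightarrow>\<^sub>M T" and b0: "b0 \<in> space T"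
    and B_0: "\<And>\<omega>. \<omega> \<in> space M \<Longrightarrow> B 0 \<omega> = b0"
    and B_Suc: "\<And>n \<omega>. \<omega> \<in> space M \<Longrightarrow> B (Suc n) \<omega> = \<Phi> (B n \<omega>) (Y (Suc n) \<omega>)"
  shows "distr M T (B (Suc n)) =
      distr (distr M T (B n) \<Otimes>\<^sub>M distr M N (Y (Suc n))) T (\<lambda>(s, y). \<Phi> s y)"
proof -
  obtain F where F: "F \<in> PiM {1..n} (\<lambda>_. N) \<rightarrow>\<^sub>M T"
    and BF: "\<And>\<omega>. \<omega> \<in> space M \<Longrightarrow> B n \<omega> = F (\<lambda>i\<in>{1..n}. Y i \<omega>)"
    using random_recursion_adapted[where \<Phi>=\<Phi> and \<Omega>="space M" and B=B and Y=Y and n=n,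
        OF \<Phi> b0 B_0 B_Suc]
    by blast
  \<comment> \<open>\<open>X\<close> and \<open>Z\<close> factor through the restrictions of the
    family \<open>Y\<close> to the disjoint index sets \<open>{1..n}\<close> and
    \<open>{Suc n}\<close>, as \<open>indep_var_restrict\<close> demands. \<open>X\<close> is only
    known to equal \<open>B n\<close> on \<open>space M\<close>, which is enough for equality of
    laws.\<close>
  define X where "X = F \<circ> (\<lambda>\<omega>. \<lambda>i\<in>{1..n}. Y i \<omega>)"
  define Z where "Z = (\<lambda>y. y (Suc n)) \<circ> (\<lambda>\<omega>. \<lambda>i\<in>{Suc n}. Y i \<omega>)"
  have "indep_var T X N Z"
    unfolding X_def Z_def
    by (intro indep_var_compose[OF indep_var_restrict[OF indep]] F measurable_component_singleton)
      auto
  then have X: "X \<in> M \<rightarrow>\<^sub>M T" and Z: "Z \<in> M \<rightarrow>\<^sub>M N"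
    and joint: "distr M T X \<Otimes>\<^sub>M distr M N Z = distr M (T \<Otimes>\<^sub>M N) (\<lambda>\<omega>. (X \<omega>, Z \<omega>))"
    by (simp_all add: indep_var_distribution_eq)
  have BX: "B n \<omega> = X \<omega>" if "\<omega> \<in> space M" for \<omega>
    using BF[OF that] by (simp add: X_def)
  have YZ: "Y (Suc n) = Z"
    by (auto simp: Z_def)
  have "distr M T (B (Suc n)) = distr M T ((\<lambda>(s, y). \<Phi> s y) \<circ> (\<lambda>\<omega>. (X \<omega>, Z \<omega>)))"
    by (intro distr_cong) (auto simp: B_Suc BX YZ)
  also have "\<dots> = distr (distr M (T \<Otimes>\<^sub>M N) (\<lambda>\<omega>. (X \<omega>, Z \<omega>))) T (\<lambda>(s, y). \<Phi> s y)"
    using X Z by (intro distr_distr[symmetric] \<Phi>) measurable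
  also have "distr M (T \<Otimes>\<^sub>M N) (\<lambda>\<omega>. (X \<omega>, Z \<omega>)) = distr M T (B n) \<Otimes>\<^sub>M distr M N (Y (Suc n))"
    unfolding joint[symmetric] YZ using BX by (metis distr_cong)
  finally show ?thesis .
qed

text \<open>The section at \<open>s\<close> of the preimage of \<open>A\<close> is the preimage of
  \<open>A\<close> under \<open>\<Phi> s\<close>. So measurability of the kernel in \<open>s\<close>
  and the Chapman-Kolmogorov formula are the two halves of the section formula for product
  measures.\<close>

lemma emeasure_distr_pair_eq_nn_integral_section:
  assumes "prob_space \<nu>" and \<Phi>: "(\<lambda>(s, y). \<Phi> s y) \<in> \<mu> \<Otimes>\<^sub>M \<nu> \<rightarrow>\<^sub>M T" and A: "A \<in> sets T"
  shows "(\<lambda>s. emeasure (distr \<nu> T (\<Phi> s)) A) \<in> borel_measurable \<mu>" (is ?meas)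
    and "emeasure (distr (\<mu> \<Otimes>\<^sub>M \<nu>) T (\<lambda>(s, y). \<Phi> s y)) A =
      (\<integral>\<^sup>+s. emeasure (distr \<nu> T (\<Phi> s)) A \<partial>\<mu>)" (is ?eq)
proof -
  interpret prob_space \<nu> by fact
  let ?P = "(\<lambda>(s, y). \<Phi> s y) -` A \<inter> space (\<mu> \<Otimes>\<^sub>M \<nu>)"
  have P: "?P \<in> sets (\<mu> \<Otimes>\<^sub>M \<nu>)"
    using \<Phi> A by (rule measurable_sets)
  have sect: "emeasure (distr \<nu> T (\<Phi> s)) A = emeasure \<nu> (Pair s -` ?P)" if s: "s \<in> space \<mu>" for s
  proof -
    have "\<Phi> s \<in> \<nu> \<rightarrow>\<^sub>M T"
      using measurable_compose[OF measurable_Pair1'[OF s] \<Phi>] by simp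
    moreover have "\<Phi> s -` A \<inter> space \<nu> = Pair s -` ?P"
      using s by (auto simp: space_pair_measure)
    ultimately show ?thesis
      using A by (simp add: emeasure_distr)
  qed
  show ?meas
    using measurable_emeasure_Pair[OF P] sect by (simp cong: measurable_cong)
  show ?eq
    unfolding emeasure_distr[OF \<Phi> A] emeasure_pair_measure_alt[OF P]
    by (intro nn_integral_cong sect[symmetric])
qed

section \<open>Evolution of the atoms and of the density\<close>

text \<open>All masses and densities take values in \<open>ennreal\<close>, so every sum and
  integral is defined without convergence conditions. The density equation holds almost everywhere
  because \<open>g (Suc n)\<close> may be any version of the derivative.\<close>

theorem mainTheorem2:
  fixes M :: "'w measure"
    and Y :: "nat \<Rightarrow> 'w \<Rightarrow> real" and B :: "nat \<Rightarrow> 'w \<Rightarrow> real"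
    and S C :: "real set" and b0 :: real
    and \<Phi> :: "real \<Rightarrow> real \<Rightarrow> real"
    and \<kappa> :: "real \<Rightarrow> real measure" and law :: "nat \<Rightarrow> real measure"
    and p :: "real \<Rightarrow> nat \<Rightarrow> ennreal" and a :: "real \<Rightarrow> real \<Rightarrow> ennreal"
    and g :: "nat \<Rightarrow> real \<Rightarrow> ennreal" and k :: "real \<Rightarrow> real \<Rightarrow> ennreal"
  assumes prob: "prob_space M"
    and indep: "prob_space.indep_vars M (\<lambda>_. borel) Y {1..}"
    and ident: "\<And>n. n \<ge> 1 \<Longrightarrow> distr M borel (Y n) = distr M borel (Y 1)"
    and S: "S \<in> sets borel"
    and \<Phi>: "(\<lambda>(s, y). \<Phi> s y) \<in> borel_on S \<Otimes>\<^sub>M borel \<rightarrow>\<^sub>M borel_on S"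
    and b0: "b0 \<in> S"
    and B_0: "\<And>\<omega>. \<omega> \<in> space M \<Longrightarrow> B 0 \<omega> = b0"
    and B_Suc: "\<And>n \<omega>. \<omega> \<in> space M \<Longrightarrow> B (Suc n) \<omega> = \<Phi> (B n \<omega>) (Y (Suc n) \<omega>)"
    and \<kappa>: "\<And>s. s \<in> S \<Longrightarrow> \<kappa> s = distr M (borel_on S) (\<lambda>\<omega>. \<Phi> s (Y 1 \<omega>))"
    and law: "\<And>n. law n = distr M (borel_on S) (B n)"
    and C: "countable C" "C \<subseteq> S"
    and law_no_sc: "\<And>n. no_singular_continuous_part S (law n)"
    and \<kappa>_no_sc: "\<And>s. s \<in> S \<Longrightarrow> no_singular_continuous_part S (\<kappa> s)"
    and law_atoms: "\<And>n. atoms (law n) \<subseteq> C"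
    and \<kappa>_atoms: "\<And>s. s \<in> S \<Longrightarrow> atoms (\<kappa> s) \<subseteq> C"
    and p: "\<And>c n. c \<in> C \<Longrightarrow> p c n = emeasure (law n) {c}"
    and a: "\<And>c s. c \<in> C \<Longrightarrow> s \<in> S \<Longrightarrow> a c s = emeasure (\<kappa> s) {c}"
    and g: "\<And>n. is_RN_deriv (leb_on (S - C)) (restrict_space (law n) (S - C)) (g n)"
    and k: "is_kernel_density S C \<kappa> k"
  shows "(\<forall>n. \<forall>A\<in>sets (borel_on S). emeasure (law n) A =
            (\<Sum>\<^sub>\<infinity>c\<in>C. p c n * emeasure (return (borel_on S) c) A)
            + (\<integral>\<^sup>+s\<in>A. g n s \<partial>leb_on (S - C)))
      \<and> (\<forall>s\<in>S. \<forall>A\<in>sets (borel_on S). emeasure (\<kappa> s) A =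
            (\<Sum>\<^sub>\<infinity>c\<in>C. a c s * emeasure (return (borel_on S) c) A)
            + (\<integral>\<^sup>+b\<in>A. k b s \<partial>leb_on (S - C)))
      \<and> (\<forall>n. \<forall>c\<in>C. p c (Suc n) =
            (\<Sum>\<^sub>\<infinity>c'\<in>C. p c' n * a c c') + (\<integral>\<^sup>+s. a c s * g n s \<partial>leb_on (S - C)))
      \<and> (\<forall>n. AE b in leb_on (S - C). g (Suc n) b =
            (\<Sum>\<^sub>\<infinity>c'\<in>C. p c' n * k b c') + (\<integral>\<^sup>+s. k b s * g n s \<partial>leb_on (S - C)))"
proof -
  interpret prob_space M by (rule prob)
  have b0': "b0 \<in> space (borel_on S)"
    using b0 by (simp add: space_restrict_space)
  note rec = distr_random_recursion_Suc[where \<Phi>=\<Phi> and B=B and Y=Y,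
      OF indep \<Phi> b0' B_0 B_Suc]
  \<comment> \<open>The common law of the innovations, with \<open>Y 1\<close> in the role of the
    generic variable; \<open>\<kappa> s\<close> is its image under \<open>\<Phi> s\<close>.\<close>
  define \<nu> where "\<nu> = distr M borel (Y 1)"
  have Y1: "Y 1 \<in> M \<rightarrow>\<^sub>M borel"
    using indep by (simp add: indep_vars_def)
  then have \<nu>: "prob_space \<nu>"
    unfolding \<nu>_def by (rule prob_space_distr)
  have \<Phi>s: "\<Phi> s \<in> borel \<rightarrow>\<^sub>M borel_on S" if "s \<in> S" for s
    using measurable_compose[OF measurable_Pair1' \<Phi>, of s] that by (simp add: space_restrict_space)
  have \<kappa>_eq: "\<kappa> s = distr \<nu> (borel_on S) (\<Phi> s)" if "s \<in> S" for s
    using \<kappa>[OF that] distr_distr[OF \<Phi>s[OF that] Y1] by (simp add: \<nu>_def comp_def)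
  have sets_law: "sets (law n) = sets (borel_on S)" for n
    by (simp add: law)
  have space_law: "space (law n) = S" for n
    by (simp add: law space_restrict_space)
  have sets_\<kappa>: "sets (\<kappa> s) = sets (borel_on S)" if "s \<in> S" for s
    by (simp add: \<kappa>[OF that])
  have law_Suc: "law (Suc n) = distr (law n \<Otimes>\<^sub>M \<nu>) (borel_on S) (\<lambda>(s, y). \<Phi> s y)" for n
    using rec[of n] ident[of "Suc n"] by (simp add: law \<nu>_def)
  have \<Phi>': "(\<lambda>(s, y). \<Phi> s y) \<in> law n \<Otimes>\<^sub>M \<nu> \<rightarrow>\<^sub>M borel_on S" for n
  proof -
    have "sets (law n \<Otimes>\<^sub>M \<nu>) = sets (borel_on S \<Otimes>\<^sub>M borel)"
      by (intro sets_pair_measure_cong) (simp_all add: sets_law \<nu>_def)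
    then show ?thesis
      using \<Phi> by (simp cong: measurable_cong_sets)
  qed
  \<comment> \<open>Measurability of the kernel is derived from that of \<open>\<Phi>\<close>. The
    formula for \<open>\<kappa> s\<close> is known only for \<open>s\<close> in \<open>S\<close>,
    which is exactly the space of \<open>law n\<close>.\<close>
  have \<kappa>_meas: "(\<lambda>s. emeasure (\<kappa> s) A) \<in> borel_measurable (law n)"
    if "A \<in> sets (borel_on S)" for A n
    using emeasure_distr_pair_eq_nn_integral_section(1)[OF \<nu> \<Phi>' that, of n]
    by (rule measurable_cong[THEN iffD1, rotated]) (simp add: space_law \<kappa>_eq)
  have chapman: "emeasure (law (Suc n)) A = (\<integral>\<^sup>+s. emeasure (\<kappa> s) A \<partial>law n)"
    if "A \<in> sets (borel_on S)" for A n
    unfolding law_Suc emeasure_distr_pair_eq_nn_integral_section(2)[OF \<nu> \<Phi>' that]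
    by (intro nn_integral_cong) (simp add: space_law \<kappa>_eq)
  \<comment> \<open>Common source of both evolution equations: \<open>A = {c}\<close> gives the
    atoms, \<open>A\<close> inside \<open>S - C\<close> the density.\<close>
  have evolve: "emeasure (law (Suc n)) A =
      (\<Sum>\<^sub>\<infinity>c'\<in>C. p c' n * emeasure (\<kappa> c') A) + (\<integral>\<^sup>+s. emeasure (\<kappa> s) A * g n s \<partial>leb_on (S - C))"
    if A: "A \<in> sets (borel_on S)" for A n
    using nn_integral_atoms_density[OF sets_law S C g \<kappa>_meas[OF A], of n]
    by (simp add: chapman[OF A] p cong: infsum_cong)
  have kd: "is_RN_deriv (leb_on (S - C)) (restrict_space (\<kappa> s) (S - C)) (\<lambda>b. k b s)"
    if "s \<in> S" for s
    using k that by (simp add: is_kernel_density_def)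

  have law_dec: "emeasure (law n) A =
      (\<Sum>\<^sub>\<infinity>c\<in>C. p c n * emeasure (return (borel_on S) c) A) + (\<integral>\<^sup>+s\<in>A. g n s \<partial>leb_on (S - C))"
    if "A \<in> sets (borel_on S)" for A n
    using emeasure_atoms_density[OF sets_law S C g that] by (simp add: p cong: infsum_cong)
  have \<kappa>_dec: "emeasure (\<kappa> s) A =
      (\<Sum>\<^sub>\<infinity>c\<in>C. a c s * emeasure (return (borel_on S) c) A) + (\<integral>\<^sup>+b\<in>A. k b s \<partial>leb_on (S - C))"
    if "s \<in> S" "A \<in> sets (borel_on S)" for s A
    using emeasure_atoms_density[OF sets_\<kappa> S C kd] that by (simp add: a cong: infsum_cong)
  have single: "{c} \<in> sets (borel_on S)" if "c \<in> C" for c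
    using that C S by (auto simp: sets_restrict_space_iff)
  have atomic: "p c (Suc n) =
      (\<Sum>\<^sub>\<infinity>c'\<in>C. p c' n * a c c') + (\<integral>\<^sup>+s. a c s * g n s \<partial>leb_on (S - C))" if c: "c \<in> C" for c n
  proof -
    \<comment> \<open>\<open>a c\<close> is tied to the kernel only at states in \<open>S\<close>;
      the summation points lie there because \<open>C\<close> is a subset of
      \<open>S\<close>.\<close>
    have "(\<Sum>\<^sub>\<infinity>c'\<in>C. p c' n * emeasure (\<kappa> c') {c}) = (\<Sum>\<^sub>\<infinity>c'\<in>C. p c' n * a c c')"
      using C(2) by (intro infsum_cong) (auto simp: a[OF c])
    moreover have "(\<integral>\<^sup>+s. emeasure (\<kappa> s) {c} * g n s \<partial>leb_on (S - C)) =
        (\<integral>\<^sup>+s. a c s * g n s \<partial>leb_on (S - C))"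
      by (intro nn_integral_cong) (simp add: space_restrict_space a[OF c])
    ultimately show ?thesis
      using evolve[OF single[OF c]] by (simp add: p[OF c])
  qed

  \<comment> \<open>The density equation, by Tonelli and uniqueness of densities\<close>
  define L where "L = leb_on (S - C)"
  have "C \<in> sets borel"
    using C(1) by (rule sets.countable[rotated]) simp
  then have SC: "S - C \<in> sets borel"
    using S by blast
  have spaceL: "space L = S - C"
    by (simp add: L_def space_restrict_space)
  have setsL: "sets L = sets (borel_on (S - C))"
    unfolding L_def by (rule sets_restrict_space_cong) simp
  \<comment> \<open>Sigma-finiteness serves twice: for exchanging the two integrals over
    \<open>L\<close>, and for almost everywhere uniqueness of densities.\<close>
  interpret L: sigma_finite_measure L
    unfolding L_def
    by (rule sigma_finite_measure_restrict_space) (use SC in \<open>auto intro: sigma_finite_lborel\<close>)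
  interpret LL: pair_sigma_finite L L ..
  have g_meas: "g n \<in> borel_measurable L" for n
    using g[of n] by (simp add: is_RN_deriv_def L_def)
  have k1_meas: "(\<lambda>b. k b s) \<in> borel_measurable L" if "s \<in> S" for s
    using kd[OF that] by (simp add: is_RN_deriv_def L_def)
  \<comment> \<open>The kernel density is jointly measurable on \<open>S - C\<close> times
    \<open>S\<close>. Composing with the inclusion in the second coordinate brings it to the square
    of \<open>S - C\<close>, where Tonelli is applied.\<close>
  have k_meas: "(\<lambda>(b, s). k b s) \<in> borel_measurable (L \<Otimes>\<^sub>M L)"
  proof -
    have "(\<lambda>s. s) \<in> L \<rightarrow>\<^sub>M borel_on (S - C)"
      by (simp add: measurable_ident_sets setsL)
    moreover have "(\<lambda>s. s) \<in> L \<rightarrow>\<^sub>M borel_on S"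
      unfolding measurable_restrict_space2_iff L_def
      by (auto simp: space_restrict_space intro: measurable_restrict_space1)
    ultimately have "(\<lambda>x. (fst x, snd x)) \<in> L \<Otimes>\<^sub>M L \<rightarrow>\<^sub>M borel_on (S - C) \<Otimes>\<^sub>M borel_on S"
      by (intro measurable_Pair measurable_compose[OF measurable_fst] measurable_compose[OF measurable_snd])
    moreover have "(\<lambda>(b, s). k b s) \<in> borel_measurable (borel_on (S - C) \<Otimes>\<^sub>M borel_on S)"
      using k by (simp add: is_kernel_density_def)
    ultimately show ?thesis
      by (auto dest: measurable_compose simp: case_prod_beta)
  qed
  have dens: "AE b in L. g (Suc n) b =
      (\<Sum>\<^sub>\<infinity>c'\<in>C. p c' n * k b c') + (\<integral>\<^sup>+s. k b s * g n s \<partial>L)" for n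
  \<comment> \<open>It suffices that both sides are measurable and have the same integral over every
    set of \<open>L\<close>.\<close>
  proof (rule L.density_unique2)
    have kg: "(\<lambda>(b, s). k b s * g n s) \<in> borel_measurable (L \<Otimes>\<^sub>M L)"
      using k_meas g_meas by measurable
    have int_meas: "(\<lambda>b. \<integral>\<^sup>+s. k b s * g n s \<partial>L) \<in> borel_measurable L"
      using L.borel_measurable_nn_integral[OF kg] .
    have kc: "(\<lambda>b. p c' n * k b c') \<in> borel_measurable L" if "c' \<in> C" for c'
      using k1_meas[of c'] that C(2) by auto
    have sum_meas: "(\<lambda>b. \<Sum>\<^sub>\<infinity>c'\<in>C. p c' n * k b c') \<in> borel_measurable L"
      using kc by (rule borel_measurable_infsum[OF C(1)])
    show "g (Suc n) \<in> borel_measurable L" by (rule g_meas)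
    show "(\<lambda>b. (\<Sum>\<^sub>\<infinity>c'\<in>C. p c' n * k b c') + (\<integral>\<^sup>+s. k b s * g n s \<partial>L)) \<in> borel_measurable L"
      using sum_meas int_meas by simp
    fix A assume A: "A \<in> sets L"
    then have ASC: "A \<subseteq> S - C" and A': "A \<in> sets (borel_on S)"
      using SC S by (auto simp: setsL sets_restrict_space_iff)
    \<comment> \<open>Since \<open>A\<close> avoids \<open>C\<close>, no point mass on
      \<open>C\<close> contributes: \<open>\<mu>\<close> and its restriction to \<open>S - C\<close>
      agree on \<open>A\<close>, and the restriction has density \<open>f\<close>.\<close>
    have density_emeasure: "emeasure \<mu> A = (\<integral>\<^sup>+b\<in>A. f b \<partial>L)"
      if "sets \<mu> = sets (borel_on S)" "is_RN_deriv L (restrict_space \<mu> (S - C)) f" for \<mu> f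
    proof -
      have "space \<mu> = S"
        using sets_eq_imp_space_eq[OF that(1)] by (simp add: space_restrict_space)
      moreover have "S - C \<in> sets \<mu>"
        using SC S by (auto simp: that(1) sets_restrict_space_iff)
      ultimately have "emeasure (restrict_space \<mu> (S - C)) A = emeasure \<mu> A"
        using ASC by (intro emeasure_restrict_space) (auto simp: Int_absorb2)
      then show ?thesis
        using that(2) A by (metis emeasure_density is_RN_deriv_def)
    qed
    have \<kappa>A: "emeasure (\<kappa> s) A = (\<integral>\<^sup>+b\<in>A. k b s \<partial>L)" if "s \<in> S" for s
      using sets_\<kappa>[OF that] kd[OF that] by (intro density_emeasure) (simp_all add: L_def)
    have "(\<integral>\<^sup>+b\<in>A. g (Suc n) b \<partial>L) = emeasure (law (Suc n)) A"
      using sets_law g by (intro density_emeasure[symmetric]) (simp_all add: L_def)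
    also have "\<dots> = (\<Sum>\<^sub>\<infinity>c'\<in>C. p c' n * emeasure (\<kappa> c') A) + (\<integral>\<^sup>+s. emeasure (\<kappa> s) A * g n s \<partial>L)"
      unfolding L_def by (rule evolve[OF A'])
    also have "(\<Sum>\<^sub>\<infinity>c'\<in>C. p c' n * emeasure (\<kappa> c') A) =
        (\<Sum>\<^sub>\<infinity>c'\<in>C. \<integral>\<^sup>+b. p c' n * k b c' * indicator A b \<partial>L)"
    proof (intro infsum_cong)
      fix c' assume "c' \<in> C"
      then have "c' \<in> S" using C(2) by blast
      have "(\<lambda>b. k b c' * indicator A b) \<in> borel_measurable L"
        using k1_meas[OF \<open>c' \<in> S\<close>] A by measurable
      then show "p c' n * emeasure (\<kappa> c') A = (\<integral>\<^sup>+b. p c' n * k b c' * indicator A b \<partial>L)"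
        by (simp add: \<kappa>A[OF \<open>c' \<in> S\<close>] nn_integral_cmult[symmetric] mult.assoc)
    qed
    also have "\<dots> = (\<integral>\<^sup>+b. (\<Sum>\<^sub>\<infinity>c'\<in>C. p c' n * k b c' * indicator A b) \<partial>L)"
      using A by (intro nn_integral_infsum[OF C(1), symmetric]
        borel_measurable_times_ennreal[OF kc borel_measurable_indicator])
    also have "\<dots> = (\<integral>\<^sup>+b\<in>A. (\<Sum>\<^sub>\<infinity>c'\<in>C. p c' n * k b c') \<partial>L)"
      by (simp add: infsum_mult_right_ennreal[OF C(1)])
    \<comment> \<open>Write the kernel mass of \<open>A\<close> as an integral of
      \<open>k b s\<close> over \<open>b\<close> and move the factor \<open>g n s\<close>, constant
      in \<open>b\<close>, inside.\<close>
    also have "(\<integral>\<^sup>+s. emeasure (\<kappa> s) A * g n s \<partial>L) = (\<integral>\<^sup>+s. \<integral>\<^sup>+b. k b s * g n s * indicator A b \<partial>L \<partial>L)"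
    proof (intro nn_integral_cong)
      fix s assume "s \<in> space L"
      then have "s \<in> S" by (simp add: spaceL)
      have "(\<lambda>b. k b s * indicator A b) \<in> borel_measurable L"
        using k1_meas[OF \<open>s \<in> S\<close>] A by measurable
      then show "emeasure (\<kappa> s) A * g n s = (\<integral>\<^sup>+b. k b s * g n s * indicator A b \<partial>L)"
        unfolding \<kappa>A[OF \<open>s \<in> S\<close>]
        by (subst nn_integral_multc[symmetric]) (simp_all add: mult.assoc mult.commute[of "g n s"])
    qed
    also have "\<dots> = (\<integral>\<^sup>+b. \<integral>\<^sup>+s. k b s * g n s * indicator A b \<partial>L \<partial>L)"
    proof (rule LL.Fubini')
      show "(\<lambda>(b, s). k b s * g n s * indicator A b) \<in> borel_measurable (L \<Otimes>\<^sub>M L)"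
        using k_meas g_meas A by measurable
    qed
    also have "\<dots> = (\<integral>\<^sup>+b\<in>A. (\<integral>\<^sup>+s. k b s * g n s \<partial>L) \<partial>L)"
    \<comment> \<open>After the exchange, \<open>indicator A b\<close> is constant in the inner
      variable \<open>s\<close> and comes out, leaving the integral term of the claimed
      density.\<close>
    proof (intro nn_integral_cong)
      fix b assume b: "b \<in> space L"
      have "(\<lambda>s. k b s * g n s) \<in> borel_measurable L"
        using measurable_compose[OF measurable_Pair1'[OF b] kg] by simp
      then show "(\<integral>\<^sup>+s. k b s * g n s * indicator A b \<partial>L) = (\<integral>\<^sup>+s. k b s * g n s \<partial>L) * indicator A b"
        by (rule nn_integral_multc)
    qed
    also have "(\<integral>\<^sup>+b\<in>A. (\<Sum>\<^sub>\<infinity>c'\<in>C. p c' n * k b c') \<partial>L) + (\<integral>\<^sup>+b\<in>A. (\<integral>\<^sup>+s. k b s * g n s \<partial>L) \<partial>L) =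
        (\<integral>\<^sup>+b\<in>A. ((\<Sum>\<^sub>\<infinity>c'\<in>C. p c' n * k b c') + (\<integral>\<^sup>+s. k b s * g n s \<partial>L)) \<partial>L)"
      using sum_meas int_meas A by (simp add: nn_integral_add[symmetric] distrib_right)
    finally show "(\<integral>\<^sup>+b\<in>A. g (Suc n) b \<partial>L) =
        (\<integral>\<^sup>+b\<in>A. ((\<Sum>\<^sub>\<infinity>c'\<in>C. p c' n * k b c') + (\<integral>\<^sup>+s. k b s * g n s \<partial>L)) \<partial>L)" .
  qed

  show ?thesis
    using law_dec \<kappa>_dec atomic dens unfolding L_def by blast
qed

end
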